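(* Let $m,n,p$ be positive integers, let $A$ be an $m\times n$ integer matrix, let $B$ be a $p\times n$ integer matrix, let $r\ge 2$ be an integer, and let $\mathcal{L}_r=\mathrm{Ker}_{\mathbb{Z}}(\Lambda(A,B,r))\subset\mathbb{Z}^{rn}$. Suppose that $\mathcal{L}_r$ is non positive, i.e. $\mathcal{L}_r\cap\mathbb{N}^{rn}\neq\{\mathbf{0}\}$. Then there exists a minimal Markov basis of $\Lambda(A,B,r)$ of minimal cardinality (i.e. of the smallest cardinality among minimal Markov bases of $\Lambda(A,B,r)$) that contains an element of type $r$.
   Context: $\mathbb{N}$ contains $0$. The generalized Lawrence lifting $\Lambda(A,B,r)$ is the $(rm+p)\times rn$ block matrix $$\Lambda(A,B,r)=\begin{pmatrix} A&0&\cdots&0\\ 0&A&\cdots&0\\ \vdots&&\ddots&\vdots\\ 0&0&\cdots&A\\ B&B&\cdots&B\end{pmatrix}$$ with $r$ copies of $A$ on the diagonal and $r$ copies of $B$ in the last block row. Each $C\in\mathcal{L}_r\subset\mathbb{Z}^{rn}$ is identified with the $r\times n$ matrix $\mathcal{C}$ with $\mathcal{C}_{i,j}=C_{(i-1)n+j}$. The type of $C$ is the number of nonzero rows of $\mathcal{C}$. Markov bases: for an integer matrix $D$ with $N$ columns and lattice $\mathcal{L}=\mathrm{Ker}_{\mathbb{Z}}(D)$, write $\mathbf{u}=\mathbf{u}^+-\mathbf{u}^-$ with $\mathbf{u}^\pm\in\mathbb{N}^N$ of disjoint support. A Markov basis of $D$ is a finite subset $M\subset\mathcal{L}$ such that any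 $\mathbf{w},\mathbf{u}\in\mathbb{N}^N$ with $D\mathbf{w}=D\mathbf{u}$ can be connected by moves from $M$ (up to sign, repetitions allowed) with all partial sums remaining in $\mathbb{N}^N$; equivalently, such that $\{x^{\mathbf{u}^+}-x^{\mathbf{u}^-}:\mathbf{u}\in M\}$ generates the lattice ideal $\langle x^{\mathbf{u}}-x^{\mathbf{v}}:\mathbf{u},\mathbf{v}\in\mathbb{N}^N,\ D\mathbf{u}=D\mathbf{v}\rangle$ of $K[x_1,\dots,x_N]$, $K$ a field. It is minimal if no proper subset of it is a Markov basis; for non positive lattices minimal Markov bases may have different cardinalities. *)

theory Defs
  imports "Jordan_Normal_Form.Matrix_Kernel"
begin

(* Rows and columns are numbered from 0.  The column j lies in block j div n, at position
   j mod n inside it; likewise for the first r * m rows. *)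
definition lawrence_lifting :: "int mat \<Rightarrow> int mat \<Rightarrow> nat \<Rightarrow> int mat" where
  "lawrence_lifting A B r =
     (let m = dim_row A; n = dim_col A; p = dim_row B in
      mat (r * m + p) (r * n) (\<lambda>(i, j).
        if i < r * m
        then (if i div m = j div n then A $$ (i mod m, j mod n) else 0)
        else B $$ (i - r * m, j mod n)))"

definition nonneg_vecs :: "nat \<Rightarrow> int vec set" where
  "nonneg_vecs N = {v \<in> carrier_vec N. \<forall>i < N. 0 \<le> v $ i}"

definition non_positive_lattice :: "nat \<Rightarrow> int vec set \<Rightarrow> bool" where
  "non_positive_lattice N L \<longleftrightarrow> L \<inter> nonneg_vecs N \<noteq> {0\<^sub>v N}"

definition markov_step :: "nat \<Rightarrow> int vec set \<Rightarrow> (int vec \<times> int vec) set" where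
  "markov_step N M =
     {(u, v). u \<in> nonneg_vecs N \<and> v \<in> nonneg_vecs N \<and> (\<exists>b \<in> M. v = u + b \<or> v = u - b)}"

definition is_markov_basis :: "int mat \<Rightarrow> int vec set \<Rightarrow> bool" where
  "is_markov_basis D M \<longleftrightarrow>
     finite M \<and> M \<subseteq> mat_kernel D \<and>
     (\<forall>w \<in> nonneg_vecs (dim_col D). \<forall>u \<in> nonneg_vecs (dim_col D).
        D *\<^sub>v w = D *\<^sub>v u \<longrightarrow> (w, u) \<in> (markov_step (dim_col D) M)\<^sup>*)"

definition is_minimal_markov_basis :: "int mat \<Rightarrow> int vec set \<Rightarrow> bool" where
  "is_minimal_markov_basis D M \<longleftrightarrow>
     is_markov_basis D M \<and> (\<forall>M'. M' \<subset> M \<longrightarrow> \<not> is_markov_basis D M')"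

definition has_minimal_cardinality :: "int mat \<Rightarrow> int vec set \<Rightarrow> bool" where
  "has_minimal_cardinality D M \<longleftrightarrow>
     (\<forall>M'. is_minimal_markov_basis D M' \<longrightarrow> card M \<le> card M')"

definition vec_to_rows :: "nat \<Rightarrow> nat \<Rightarrow> int vec \<Rightarrow> int mat" where
  "vec_to_rows r n C = mat r n (\<lambda>(i, j). C $ (i * n + j))"

definition vec_type :: "nat \<Rightarrow> nat \<Rightarrow> int vec \<Rightarrow> nat" where
  "vec_type r n C = card {i. i < r \<and> row (vec_to_rows r n C) i \<noteq> 0\<^sub>v n}"

end

theory Submission
  imports Defs
begin

text \<open>Conformally minimal kernel elements form a Markov basis, finite by Dickson's lemma, so a Markov
  basis \<open>M\<close> of least cardinality exists. Summing the rows of a nonzero nonnegative kernel element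
  and repeating the result in every row gives a nonnegative kernel element \<open>x\<close> of type \<open>r\<close>. A path
  in \<open>M\<close> from 0 to \<open>x\<close> yields a nonnegative \<open>u\<close>, an integer combination of moves supported in the
  support of \<open>u\<close>, in which some move \<open>b\<close> has coefficient \<open>\<plusminus>1\<close>, and the support of \<open>u\<close> contains that of
  \<open>x\<close>. Then \<open>b\<close> may be exchanged for \<open>u\<close>: adding a large multiple of \<open>u\<close> first makes room for
  simulating the move \<open>b\<close> by \<open>u\<close> and the other moves.\<close>

section \<open>Dickson's lemma\<close>

text \<open>Every sequence has a monotone subsequence, and a decreasing one of natural numbers is
  constant from the place where it attains its least value.\<close>

lemma nat_incseq_subseq:
  fixes f :: "nat \<Rightarrow> nat"
  shows "\<exists>\<phi>. strict_mono \<phi> \<and> incseq (f \<circ> \<phi>)"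
proof -
  obtain \<phi> where \<phi>: "strict_mono \<phi>" "monoseq (\<lambda>k. f (\<phi> k))"
    using seq_monosub[of f] by (auto simp: comp_def)
  show ?thesis
  proof (cases "incseq (\<lambda>k. f (\<phi> k))")
    case True
    then show ?thesis using \<phi>(1) by (auto simp: comp_def)
  next
    case False
    then have dec: "decseq (\<lambda>k. f (\<phi> k))"
      using \<phi>(2) by (auto simp: monoseq_iff)
    obtain k where k: "\<And>l. f (\<phi> k) \<le> f (\<phi> l)"
      using ex_has_least_nat[of "\<lambda>_. True" _ "\<lambda>k. f (\<phi> k)"] by auto
    have "f (\<phi> (k + l)) = f (\<phi> k)" for l
      using k[of "k + l"] decseqD[OF dec, of k "k + l"] by simp
    moreover have "strict_mono (\<lambda>l. \<phi> (k + l))"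
      using \<phi>(1) by (auto simp: strict_mono_def)
    ultimately show ?thesis
      by (intro exI[of _ "\<lambda>l. \<phi> (k + l)"]) (auto simp: incseq_def)
  qed
qed

text \<open>One coordinate is treated at a time: each refinement of the subsequence preserves
  monotonicity in the coordinates already treated.\<close>

lemma dickson:
  fixes f :: "nat \<Rightarrow> 'i \<Rightarrow> nat"
  assumes "finite I"
  shows "\<exists>\<phi>. strict_mono \<phi> \<and> (\<forall>i\<in>I. incseq (\<lambda>k. f (\<phi> k) i))"
  using assms
proof (induction I)
  case empty
  show ?case by (auto intro: exI[of _ id] simp: strict_mono_def)
next
  case (insert i I)
  then obtain \<phi> where \<phi>: "strict_mono \<phi>" "\<And>j. j \<in> I \<Longrightarrow> incseq (\<lambda>k. f (\<phi> k) j)"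
    by auto
  obtain \<psi> where \<psi>: "strict_mono \<psi>" "incseq ((\<lambda>k. f (\<phi> k) i) \<circ> \<psi>)"
    using nat_incseq_subseq by blast
  have "incseq (\<lambda>k. f ((\<phi> \<circ> \<psi>) k) j)" if "j \<in> I" for j
    using \<phi>(2)[OF that] \<psi>(1) by (auto simp: incseq_def strict_mono_less_eq)
  then show ?case
    using \<phi>(1) \<psi> by (intro exI[of _ "\<phi> \<circ> \<psi>"]) (auto simp: strict_mono_def comp_def)
qed

section \<open>The conformal order and the Graver basis\<close>

text \<open>Since \<open>nat\<close> cuts negative values off to 0, the two inequalities compare
  positive parts and negative parts. Thus \<open>g\<close> never has the sign opposite to that of
  \<open>v\<close>, and is bounded by \<open>v\<close> in absolute value.\<close>

definition conformal_le :: "nat \<Rightarrow> int vec \<Rightarrow> int vec \<Rightarrow> bool" where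
  "conformal_le N g v \<longleftrightarrow>
     (\<forall>i<N. nat (g $ i) \<le> nat (v $ i) \<and> nat (- g $ i) \<le> nat (- v $ i))"

lemma conformal_le_refl: "conformal_le N v v"
  by (simp add: conformal_le_def)

lemma conformal_le_trans:
  "conformal_le N u v \<Longrightarrow> conformal_le N v w \<Longrightarrow> conformal_le N u w"
  by (force simp: conformal_le_def)

lemma conformal_leD:
  assumes "conformal_le N g v" "i < N"
  shows "0 \<le> v $ i \<and> 0 \<le> g $ i \<and> g $ i \<le> v $ i \<or> v $ i \<le> 0 \<and> g $ i \<le> 0 \<and> v $ i \<le> g $ i"
proof -
  have "nat (g $ i) \<le> nat (v $ i) \<and> nat (- g $ i) \<le> nat (- v $ i)"
    using assms by (simp add: conformal_le_def)
  then show ?thesis by linarith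
qed

definition abs_sum :: "int vec \<Rightarrow> nat" where
  "abs_sum v = (\<Sum>i<dim_vec v. nat \<bar>v $ i\<bar>)"

text \<open>In each coordinate \<open>g\<close> and \<open>v - g\<close> have no opposite signs, so
  nothing cancels and the 1-norms add up.\<close>

lemma conformal_le_abs_sum:
  assumes "conformal_le N g v" "g \<in> carrier_vec N" "v \<in> carrier_vec N"
  shows "abs_sum g + abs_sum (v - g) = abs_sum v"
proof -
  have "nat \<bar>g $ i\<bar> + nat \<bar>(v - g) $ i\<bar> = nat \<bar>v $ i\<bar>" if "i < N" for i
  proof -
    have "(v - g) $ i = v $ i - g $ i" using assms that by simp
    then show ?thesis using conformal_leD[OF assms(1) that] by arith
  qed
  then show ?thesis
    using assms by (simp add: abs_sum_def flip: sum.distrib)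
qed

lemma abs_sum_pos:
  assumes "v \<in> carrier_vec N" "v \<noteq> 0\<^sub>v N"
  shows "0 < abs_sum v"
proof -
  obtain i where "i < N" "v $ i \<noteq> 0"
    using assms by (metis carrier_vecD eq_vecI index_zero_vec)
  then show ?thesis
    using assms(1) by (auto simp: abs_sum_def intro!: sum_pos2[of _ i])
qed

definition graver_basis :: "nat \<Rightarrow> int vec set \<Rightarrow> int vec set" where
  "graver_basis N L =
     {g \<in> L - {0\<^sub>v N}. \<forall>h \<in> L - {0\<^sub>v N}. conformal_le N h g \<longrightarrow> h = g}"

text \<open>An infinite set would contain, by Dickson's lemma, two distinct conformally comparable
  elements, against minimality.\<close>

lemma finite_graver_basis: "finite (graver_basis N L)"
proof (rule ccontr)
  assume "infinite (graver_basis N L)"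
  then obtain g :: "nat \<Rightarrow> int vec" where g: "inj g" "range g \<subseteq> graver_basis N L"
    using infinite_countable_subset by blast
  \<comment> \<open>The boolean selects the positive or the negative part, so an integer vector
    becomes a family of 2 \<open>N\<close> natural numbers, ordered coordinatewise.\<close>
  define f where "f k = (\<lambda>(i, s). nat (if s then g k $ i else - g k $ i))" for k
  obtain \<phi> where \<phi>: "strict_mono \<phi>" "\<forall>i\<in>{..<N} \<times> UNIV. incseq (\<lambda>k. f (\<phi> k) i)"
    using dickson[of "{..<N} \<times> (UNIV :: bool set)" f] by auto
  have "conformal_le N (g (\<phi> 0)) (g (\<phi> 1))"
    unfolding conformal_le_def
  proof (intro allI impI conjI)
    fix i assume "i < N"
    then have "f (\<phi> 0) (i, s) \<le> f (\<phi> 1) (i, s)" for s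
      using \<phi>(2) by (auto dest!: bspec[of _ _ "(i, s)"] simp: incseq_def)
    from this[of True] this[of False]
    show "nat (g (\<phi> 0) $ i) \<le> nat (g (\<phi> 1) $ i)"
      and "nat (- g (\<phi> 0) $ i) \<le> nat (- g (\<phi> 1) $ i)"
      by (simp_all add: f_def)
  qed
  moreover have "g (\<phi> 0) \<in> graver_basis N L" "g (\<phi> 1) \<in> graver_basis N L"
    using g(2) by auto
  ultimately have "g (\<phi> 0) = g (\<phi> 1)"
    unfolding graver_basis_def by blast
  then have "\<phi> 0 = \<phi> 1" using g(1) by (simp add: inj_eq)
  then show False using \<phi>(1) by (simp add: strict_mono_eq)
qed

text \<open>An element of least 1-norm among the nonzero elements of \<open>L\<close> below
  \<open>v\<close> is conformally minimal: by additivity of the norm, anything different below it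
  would have smaller norm.\<close>

lemma graver_basis_conformal_le:
  assumes "L \<subseteq> carrier_vec N" "v \<in> L" "v \<noteq> 0\<^sub>v N"
  obtains g where "g \<in> graver_basis N L" "conformal_le N g v"
proof -
  let ?P = "\<lambda>g. g \<in> L - {0\<^sub>v N} \<and> conformal_le N g v"
  have "?P v" using assms by (simp add: conformal_le_refl)
  then obtain g where g: "?P g" and min: "\<And>h. ?P h \<Longrightarrow> abs_sum g \<le> abs_sum h"
    using ex_has_least_nat[of ?P v abs_sum] by blast
  have "h = g" if h: "h \<in> L - {0\<^sub>v N}" "conformal_le N h g" for h
  proof (rule ccontr)
    assume "h \<noteq> g"
    have c: "h \<in> carrier_vec N" "g \<in> carrier_vec N" using g h assms(1) by auto
    have "g - h \<noteq> 0\<^sub>v N"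
    proof
      assume z: "g - h = 0\<^sub>v N"
      have "h $ i = g $ i" if "i < N" for i
        using arg_cong[OF z, of "\<lambda>v. v $ i"] c that by simp
      then show False using \<open>h \<noteq> g\<close> c by (metis carrier_vecD eq_vecI)
    qed
    then have "0 < abs_sum (g - h)" using c by (intro abs_sum_pos[of _ N]) auto
    moreover have "abs_sum g \<le> abs_sum h"
      using h g by (intro min) (auto intro: conformal_le_trans)
    ultimately show False using conformal_le_abs_sum[OF h(2) c] by simp
  qed
  then have "g \<in> graver_basis N L" using g by (auto simp: graver_basis_def)
  then show thesis using g that by blast
qed

section \<open>Kernel arithmetic and connectivity by the Graver basis\<close>

lemma mat_kernel_carrier: "mat_kernel D \<subseteq> carrier_vec (dim_col D)"
  by (auto simp: mat_kernel_def)

lemma mat_kernel_add: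
  fixes D :: "int mat"
  assumes "u \<in> mat_kernel D" "v \<in> mat_kernel D"
  shows "u + v \<in> mat_kernel D"
proof -
  have "D *\<^sub>v (u + v) = D *\<^sub>v u + D *\<^sub>v v"
    using assms by (intro mult_add_distrib_mat_vec[of _ "dim_row D" "dim_col D"])
      (auto simp: mat_kernel_def)
  then show ?thesis using assms by (auto simp: mat_kernel_def)
qed

lemma mat_kernel_minus:
  fixes D :: "int mat"
  assumes "u \<in> mat_kernel D" "v \<in> mat_kernel D"
  shows "u - v \<in> mat_kernel D"
proof -
  have "D *\<^sub>v (u - v) = D *\<^sub>v u - D *\<^sub>v v"
    using assms by (intro mult_minus_distrib_mat_vec[of _ "dim_row D" "dim_col D"])
      (auto simp: mat_kernel_def)
  then show ?thesis using assms by (auto simp: mat_kernel_def)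
qed

lemma mat_kernel_diffI:
  fixes D :: "int mat"
  assumes "D *\<^sub>v u = D *\<^sub>v w" "u \<in> carrier_vec (dim_col D)" "w \<in> carrier_vec (dim_col D)"
  shows "u - w \<in> mat_kernel D"
proof -
  have "D *\<^sub>v (u - w) = D *\<^sub>v u - D *\<^sub>v w"
    using assms by (intro mult_minus_distrib_mat_vec[of _ "dim_row D" "dim_col D"]) auto
  then show ?thesis using assms by (auto simp: mat_kernel_def)
qed

lemma markov_stepI_add:
  "u \<in> nonneg_vecs N \<Longrightarrow> u + b \<in> nonneg_vecs N \<Longrightarrow> b \<in> M \<Longrightarrow> (u, u + b) \<in> markov_step N M"
  by (auto simp: markov_step_def)

text \<open>A Graver element \<open>g\<close> conformally below \<open>u - w\<close> puts
  \<open>w + g\<close> coordinatewise between \<open>w\<close> and \<open>u\<close>. Hence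
  \<open>w + g\<close> is nonnegative, and its 1-norm distance to \<open>u\<close> is
  smaller.\<close>

lemma graver_basis_connects:
  fixes D :: "int mat"
  defines "N \<equiv> dim_col D"
  assumes "w \<in> nonneg_vecs N" "u \<in> nonneg_vecs N" "u - w \<in> mat_kernel D"
  shows "(w, u) \<in> (markov_step N (graver_basis N (mat_kernel D)))\<^sup>*"
  using assms(2-)
proof (induction "abs_sum (u - w)" arbitrary: w rule: less_induct)
  case less
  note K = mat_kernel_carrier[of D, folded N_def]
  have c: "w \<in> carrier_vec N" "u \<in> carrier_vec N" using less.prems by (auto simp: nonneg_vecs_def)
  show ?case
  proof (cases "u - w = 0\<^sub>v N")
    case True
    have "w $ i = u $ i" if "i < N" for i
      using arg_cong[OF True, of "\<lambda>v. v $ i"] c that by simp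
    then have "w = u" using c by auto
    then show ?thesis by simp
  next
    case False
    obtain g where g: "g \<in> graver_basis N (mat_kernel D)" "conformal_le N g (u - w)"
      using graver_basis_conformal_le[OF K less.prems(3) False] .
    have gK: "g \<in> mat_kernel D" "g \<noteq> 0\<^sub>v N" using g(1) by (auto simp: graver_basis_def)
    have gc: "g \<in> carrier_vec N" using gK K by auto
    have "0 \<le> (w + g) $ i" if "i < N" for i
    proof -
      have "0 \<le> w $ i" "0 \<le> u $ i" using less.prems that by (auto simp: nonneg_vecs_def)
      moreover have "(u - w) $ i = u $ i - w $ i" "(w + g) $ i = w $ i + g $ i"
        using c gc that by auto
      ultimately show ?thesis using conformal_leD[OF g(2) that] by linarith
    qed
    then have wg: "w + g \<in> nonneg_vecs N" using c gc by (auto simp: nonneg_vecs_def)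
    have eq: "u - (w + g) = (u - w) - g" using c gc by (intro eq_vecI) auto
    have "abs_sum (u - (w + g)) < abs_sum (u - w)"
      using conformal_le_abs_sum[OF g(2) gc] abs_sum_pos[OF gc gK(2)] c by (simp add: eq)
    moreover have "u - (w + g) \<in> mat_kernel D"
      unfolding eq using less.prems(3) gK(1) by (rule mat_kernel_minus)
    ultimately have "(w + g, u) \<in> (markov_step N (graver_basis N (mat_kernel D)))\<^sup>*"
      using less.hyps wg less.prems(2) by blast
    then show ?thesis
      using markov_stepI_add[OF less.prems(1) wg g(1)] by (meson converse_rtrancl_into_rtrancl)
  qed
qed

lemma is_markov_basis_graver: "is_markov_basis D (graver_basis (dim_col D) (mat_kernel D))"
  unfolding is_markov_basis_def
proof (intro conjI ballI impI)
  show "graver_basis (dim_col D) (mat_kernel D) \<subseteq> mat_kernel D" by (auto simp: graver_basis_def)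
  fix w u assume a: "w \<in> nonneg_vecs (dim_col D)" "u \<in> nonneg_vecs (dim_col D)"
    and "D *\<^sub>v w = D *\<^sub>v u"
  then have "u - w \<in> mat_kernel D" by (intro mat_kernel_diffI) (auto simp: nonneg_vecs_def)
  then show "(w, u) \<in> (markov_step (dim_col D) (graver_basis (dim_col D) (mat_kernel D)))\<^sup>*"
    by (rule graver_basis_connects[OF a])
qed (rule finite_graver_basis)

section \<open>Integer combinations of moves and their supports\<close>

text \<open>Integer combinations are built by one signed element at a time, so that inductions over
  them run through partial sums just as a path of moves does.\<close>

inductive_set int_span :: "nat \<Rightarrow> int vec set \<Rightarrow> int vec set" for N Q where
  zero: "0\<^sub>v N \<in> int_span N Q"
| step: "x \<in> int_span N Q \<Longrightarrow> b \<in> Q \<Longrightarrow> y = x + b \<or> y = x - b \<Longrightarrow> y \<in> int_span N Q"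

lemma int_span_carrier:
  "x \<in> int_span N Q \<Longrightarrow> Q \<subseteq> carrier_vec N \<Longrightarrow> x \<in> carrier_vec N"
  by (induction rule: int_span.induct) auto

lemma int_span_mono: "x \<in> int_span N Q \<Longrightarrow> Q \<subseteq> Q' \<Longrightarrow> x \<in> int_span N Q'"
  by (induction rule: int_span.induct) (auto intro: int_span.intros)

lemma int_span_sum:
  assumes "y \<in> int_span N Q" "x \<in> int_span N Q" "Q \<subseteq> carrier_vec N"
  shows "x + y \<in> int_span N Q"
  using assms
proof (induction rule: int_span.induct)
  case zero
  then show ?case using int_span_carrier[of x N Q] by simp
next
  case (step y b z)
  have "x \<in> carrier_vec N" "y \<in> carrier_vec N" "b \<in> carrier_vec N"
    using int_span_carrier step by auto
  then have "x + z = (x + y) + b \<or> x + z = (x + y) - b"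
    using step.hyps(3) by (auto intro!: eq_vecI)
  then show ?case using step by (blast intro: int_span.step[of "x + y"])
qed

lemma int_span_smult:
  assumes "x \<in> int_span N Q" "Q \<subseteq> carrier_vec N"
  shows "int k \<cdot>\<^sub>v x \<in> int_span N Q"
proof (induction k)
  case 0
  have "int 0 \<cdot>\<^sub>v x = 0\<^sub>v N" using int_span_carrier[OF assms] by auto
  then show ?case using int_span.zero[of N Q] by metis
next
  case (Suc k)
  have "int (Suc k) \<cdot>\<^sub>v x = x + int k \<cdot>\<^sub>v x"
    using int_span_carrier[OF assms] by (intro eq_vecI) (auto simp: algebra_simps)
  then show ?case using int_span_sum[OF Suc assms] by simp
qed

lemma int_span_kernel:
  fixes D :: "int mat"
  assumes "x \<in> int_span (dim_col D) Q" "Q \<subseteq> mat_kernel D"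
  shows "x \<in> mat_kernel D"
  using assms
proof (induction rule: int_span.induct)
  case zero
  show ?case by (auto simp: mat_kernel_def intro!: eq_vecI)
next
  case (step x b y)
  then show ?case using mat_kernel_add mat_kernel_minus by blast
qed

definition supp_le :: "nat \<Rightarrow> int vec \<Rightarrow> int vec \<Rightarrow> bool" where
  "supp_le N x u \<longleftrightarrow> (\<forall>i<N. u $ i = 0 \<longrightarrow> x $ i = 0)"

lemma int_span_supp_le:
  "x \<in> int_span N Q \<Longrightarrow> Q \<subseteq> carrier_vec N \<Longrightarrow> \<forall>c\<in>Q. supp_le N c u \<Longrightarrow> supp_le N x u"
proof (induction rule: int_span.induct)
  case (step x b y)
  then have "x \<in> carrier_vec N" "b \<in> carrier_vec N" using int_span_carrier by auto
  then show ?case using step by (auto simp: supp_le_def)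
qed (simp add: supp_le_def)

text \<open>A nonzero coordinate of \<open>u\<close> is at least 1, being a nonnegative integer, so
  the 1-norm of \<open>x\<close> serves as a bound \<open>K\<close> for all coordinates at
  once.\<close>

lemma supp_le_dominated:
  assumes "u \<in> nonneg_vecs N" "supp_le N x u"
  obtains K where "\<And>k i. K \<le> k \<Longrightarrow> i < N \<Longrightarrow> \<bar>x $ i\<bar> \<le> int k * u $ i"
proof
  fix k i assume k: "(\<Sum>i<N. nat \<bar>x $ i\<bar>) \<le> k" and i: "i < N"
  have "nat \<bar>x $ i\<bar> \<le> (\<Sum>i<N. nat \<bar>x $ i\<bar>)" using i by (intro member_le_sum) auto
  then have le: "\<bar>x $ i\<bar> \<le> int k" using k by linarith
  show "\<bar>x $ i\<bar> \<le> int k * u $ i"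
  proof (cases "u $ i = 0")
    case True
    then show ?thesis using assms(2) i by (simp add: supp_le_def)
  next
    case False
    then have "1 \<le> u $ i" using assms(1) i by (force simp: nonneg_vecs_def)
    then have "int k * 1 \<le> int k * u $ i" by (intro mult_left_mono) auto
    then show ?thesis using le by simp
  qed
qed

section \<open>Paths of moves: reversal, repetition, translation and the pivot\<close>

lemma nonneg_vecs_add:
  "u \<in> nonneg_vecs N \<Longrightarrow> v \<in> nonneg_vecs N \<Longrightarrow> u + v \<in> nonneg_vecs N"
  by (auto simp: nonneg_vecs_def)

lemma markov_step_sym:
  assumes "M \<subseteq> carrier_vec N" "(u, v) \<in> markov_step N M"
  shows "(v, u) \<in> markov_step N M"
proof -
  obtain b where b: "b \<in> M" "v = u + b \<or> v = u - b"
    and uv: "u \<in> nonneg_vecs N" "v \<in> nonneg_vecs N"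
    using assms(2) by (auto simp: markov_step_def)
  have "b \<in> carrier_vec N" "u \<in> carrier_vec N" using b assms uv by (auto simp: nonneg_vecs_def)
  then have "u = v - b \<or> u = v + b" using b(2) by (auto intro!: eq_vecI)
  then show ?thesis using b(1) uv by (auto simp: markov_step_def)
qed

lemma markov_steps_sym:
  assumes "M \<subseteq> carrier_vec N" "(u, v) \<in> (markov_step N M)\<^sup>*"
  shows "(v, u) \<in> (markov_step N M)\<^sup>*"
  using assms(2) by (induction rule: rtrancl_induct)
    (auto intro: converse_rtrancl_into_rtrancl markov_step_sym[OF assms(1)])

text \<open>Adding a nonnegative move never leaves the nonnegative vectors, so it can be repeated
  from any starting point.\<close>

lemma markov_steps_multiple:
  assumes "u \<in> M" "u \<in> nonneg_vecs N" "w \<in> nonneg_vecs N"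
  shows "(w, w + int k \<cdot>\<^sub>v u) \<in> (markov_step N M)\<^sup>*"
proof (induction k)
  case 0
  have "w + int 0 \<cdot>\<^sub>v u = w" using assms by (auto simp: nonneg_vecs_def intro!: eq_vecI)
  then show ?case by (metis rtrancl.rtrancl_refl)
next
  case (Suc k)
  have eq: "w + int (Suc k) \<cdot>\<^sub>v u = (w + int k \<cdot>\<^sub>v u) + u"
    using assms by (auto simp: nonneg_vecs_def algebra_simps intro!: eq_vecI)
  have "w + int k \<cdot>\<^sub>v u \<in> nonneg_vecs N" using assms by (auto simp: nonneg_vecs_def)
  then have "(w + int k \<cdot>\<^sub>v u, w + int (Suc k) \<cdot>\<^sub>v u) \<in> markov_step N M"
    unfolding eq using assms by (blast intro: markov_stepI_add nonneg_vecs_add)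
  then show ?case using Suc by (rule rtrancl_into_rtrancl[rotated])
qed

text \<open>All partial sums of the combination \<open>x\<close> have support inside that of
  \<open>u\<close>, so a large multiple of \<open>u\<close> keeps them nonnegative. The claim is
  made for all large \<open>k\<close>, not for one, so that the bounds of successive steps can be
  combined by a maximum.\<close>

lemma markov_steps_translate:
  assumes "x \<in> int_span N Q" "Q \<subseteq> M" "Q \<subseteq> carrier_vec N"
    and "\<forall>c\<in>Q. supp_le N c u" "u \<in> nonneg_vecs N" "w \<in> nonneg_vecs N"
  shows "\<exists>K. \<forall>k\<ge>K. (w + int k \<cdot>\<^sub>v u, w + x + int k \<cdot>\<^sub>v u) \<in> (markov_step N M)\<^sup>*"
  using assms(1)
proof (induction rule: int_span.induct)
  case zero
  then show ?case using assms by (auto simp: nonneg_vecs_def)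
next
  case (step x b y)
  from step.IH obtain K where K: "\<And>k. K \<le> k \<Longrightarrow>
      (w + int k \<cdot>\<^sub>v u, w + x + int k \<cdot>\<^sub>v u) \<in> (markov_step N M)\<^sup>*" by blast
  have y: "y \<in> int_span N Q" using step.hyps by (rule int_span.step)
  have c: "x \<in> carrier_vec N" "b \<in> carrier_vec N" "u \<in> carrier_vec N"
    "w \<in> carrier_vec N" "y \<in> carrier_vec N"
    using int_span_carrier y step assms by (auto simp: nonneg_vecs_def)
  have w: "\<And>i. i < N \<Longrightarrow> 0 \<le> w $ i" using assms(6) by (auto simp: nonneg_vecs_def)
  \<comment> \<open>\<open>K1\<close> and \<open>K2\<close> make the two ends of the new step
    nonnegative, while \<open>K\<close> takes care of the path before it.\<close>
  obtain K1 where K1: "\<And>k i. K1 \<le> k \<Longrightarrow> i < N \<Longrightarrow> \<bar>x $ i\<bar> \<le> int k * u $ i"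
    using supp_le_dominated[OF assms(5) int_span_supp_le[OF step.hyps(1) assms(3,4)]] by blast
  obtain K2 where K2: "\<And>k i. K2 \<le> k \<Longrightarrow> i < N \<Longrightarrow> \<bar>y $ i\<bar> \<le> int k * u $ i"
    using supp_le_dominated[OF assms(5) int_span_supp_le[OF y assms(3,4)]] by blast
  have "(w + int k \<cdot>\<^sub>v u, w + y + int k \<cdot>\<^sub>v u) \<in> (markov_step N M)\<^sup>*"
    if k: "max K (max K1 K2) \<le> k" for k
  proof -
    have "w + x + int k \<cdot>\<^sub>v u \<in> nonneg_vecs N"
      unfolding nonneg_vecs_def
    proof (intro CollectI conjI allI impI)
      fix i assume i: "i < N"
      have "\<bar>x $ i\<bar> \<le> int k * u $ i" using k i by (intro K1) auto
      then show "0 \<le> (w + x + int k \<cdot>\<^sub>v u) $ i" using w[OF i] i c by simp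
    qed (use c in simp)
    moreover have "w + y + int k \<cdot>\<^sub>v u \<in> nonneg_vecs N"
      unfolding nonneg_vecs_def
    proof (intro CollectI conjI allI impI)
      fix i assume i: "i < N"
      have "\<bar>y $ i\<bar> \<le> int k * u $ i" using k i by (intro K2) auto
      then show "0 \<le> (w + y + int k \<cdot>\<^sub>v u) $ i" using w[OF i] i c by simp
    qed (use c in simp)
    moreover have "w + y + int k \<cdot>\<^sub>v u = w + x + int k \<cdot>\<^sub>v u + b \<or>
        w + y + int k \<cdot>\<^sub>v u = w + x + int k \<cdot>\<^sub>v u - b"
      using step.hyps(3) c by (auto intro!: eq_vecI)
    ultimately have "(w + x + int k \<cdot>\<^sub>v u, w + y + int k \<cdot>\<^sub>v u) \<in> markov_step N M"
      using step.hyps assms(2) by (auto simp: markov_step_def)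
    then show ?thesis using K[of k] k by (meson max.boundedE rtrancl_into_rtrancl)
  qed
  then show ?case by blast
qed

text \<open>The last move \<open>b\<close> used for the first time on the path from 0 can be made nonnegative by
  adding a large multiple of a nonnegative vector whose support contains all earlier supports.\<close>

lemma markov_path_pivot:
  assumes M: "M \<subseteq> carrier_vec N" and path: "(0\<^sub>v N, x) \<in> (markov_step N M)\<^sup>*"
  shows "\<exists>Q u. Q \<subseteq> M \<and> u \<in> nonneg_vecs N \<and> u \<in> int_span N Q \<and> (\<forall>c\<in>Q. supp_le N c u)
    \<and> supp_le N x u
    \<and> (u = 0\<^sub>v N \<or> (\<exists>b\<in>Q. u - b \<in> int_span N (Q - {b}) \<or> u + b \<in> int_span N (Q - {b})))"
  using path
proof (induction rule: rtrancl_induct)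
  case base
  \<comment> \<open>Before any move is used there is no candidate for \<open>b\<close>; the
    alternative that \<open>u\<close> is zero covers this case.\<close>
  show ?case
    by (intro exI[of _ "{}"] exI[of _ "0\<^sub>v N"])
      (auto simp: nonneg_vecs_def supp_le_def intro: int_span.zero)
next
  case (step x y)
  then obtain Q u where Q: "Q \<subseteq> M" "u \<in> nonneg_vecs N" "u \<in> int_span N Q"
    "\<forall>c\<in>Q. supp_le N c u" "supp_le N x u"
    and pivot: "u = 0\<^sub>v N \<or>
      (\<exists>b\<in>Q. u - b \<in> int_span N (Q - {b}) \<or> u + b \<in> int_span N (Q - {b}))" by blast
  obtain b where b: "b \<in> M" "y = x + b \<or> y = x - b"
    and xy: "x \<in> nonneg_vecs N" "y \<in> nonneg_vecs N"
    using step.hyps(2) by (auto simp: markov_step_def)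
  have c: "b \<in> carrier_vec N" "x \<in> carrier_vec N" "u \<in> carrier_vec N" "y \<in> carrier_vec N"
    using b(1) M xy Q(2) by (auto simp: nonneg_vecs_def)
  have Qc: "Q \<subseteq> carrier_vec N" using Q(1) M by blast
  show ?case
  proof (cases "b \<in> Q")
    case True
    \<comment> \<open>A move in \<open>Q\<close> has its support inside that of \<open>u\<close>, so
      the old \<open>Q\<close>, \<open>u\<close> and pivot still serve for \<open>y\<close>.\<close>
    then have "supp_le N y u" using b(2) Q(4,5) c by (auto simp: supp_le_def)
    then show ?thesis using Q pivot by blast
  next
    case False
    obtain K where K: "\<And>i. i < N \<Longrightarrow> \<bar>x $ i\<bar> \<le> int K * u $ i"
      using supp_le_dominated[OF Q(2,5)] by (metis order_refl)
    \<comment> \<open>\<open>K\<close> copies of \<open>u\<close> outweigh the subtracted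
      \<open>x\<close>. The one extra copy makes \<open>u'\<close> at least \<open>u + y\<close>, so
      that \<open>u'\<close> vanishes only where both \<open>u\<close> and \<open>y\<close>
      do.\<close>
    define v where "v = int (Suc K) \<cdot>\<^sub>v u"
    define u' where "u' = v + (y - x)"
    have vc: "v \<in> carrier_vec N" using c by (simp add: v_def)
    have u'c: "u' \<in> carrier_vec N" using c vc by (simp add: u'_def)
    have v: "v \<in> int_span N Q" unfolding v_def by (rule int_span_smult[OF Q(3) Qc])
    have u'b: "u' = v + b \<or> u' = v - b"
      using b(2) c vc unfolding u'_def by (auto intro!: eq_vecI)
    have bounds: "0 \<le> u' $ i" "u' $ i = 0 \<longrightarrow> u $ i = 0 \<and> y $ i = 0 \<and> b $ i = 0"
      if i: "i < N" for i
    proof -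
      have nn: "0 \<le> u $ i" "0 \<le> y $ i" "0 \<le> x $ i"
        using xy Q(2) i by (auto simp: nonneg_vecs_def)
      have u': "u' $ i = int K * u $ i + u $ i + (y $ i - x $ i)"
        using c i by (simp add: u'_def v_def algebra_simps)
      then show "0 \<le> u' $ i" using nn K[OF i] by linarith
      show "u' $ i = 0 \<longrightarrow> u $ i = 0 \<and> y $ i = 0 \<and> b $ i = 0"
      proof
        assume "u' $ i = 0"
        then have z: "u $ i = 0" "y $ i = 0" using u' nn K[OF i] by linarith+
        moreover have "x $ i = 0" using z(1) Q(5) i by (simp add: supp_le_def)
        moreover have "y $ i = x $ i + b $ i \<or> y $ i = x $ i - b $ i"
          using b(2) c i by auto
        ultimately show "u $ i = 0 \<and> y $ i = 0 \<and> b $ i = 0" by simp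
      qed
    qed
    have "u' \<in> nonneg_vecs N" using bounds(1) u'c by (simp add: nonneg_vecs_def)
    moreover have "u' \<in> int_span N (insert b Q)"
      using int_span_mono[OF v, of "insert b Q"] u'b by (blast intro: int_span.step[of v])
    moreover have "supp_le N y u'" "supp_le N b u'" using bounds(2) by (simp_all add: supp_le_def)
    moreover have "supp_le N d u'" if "d \<in> Q" for d
      using Q(4) that bounds(2) by (simp add: supp_le_def)
    \<comment> \<open>As \<open>b\<close> is not in \<open>Q\<close>, the vector \<open>v\<close> is
      a combination without \<open>b\<close>. So \<open>b\<close> has coefficient 1 or -1 in
      \<open>u'\<close> and becomes the new pivot.\<close>
    moreover have "u' - b = v \<or> u' + b = v" using u'b c vc by (auto intro!: eq_vecI)
    then have "u' - b \<in> int_span N (insert b Q - {b}) \<or> u' + b \<in> int_span N (insert b Q - {b})"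
      using v False by auto
    ultimately show ?thesis
      using Q(1) b(1) by (intro exI[of _ "insert b Q"] exI[of _ u']) blast
  qed
qed

section \<open>Exchanging the pivot move, and bases of least cardinality\<close>

text \<open>With coefficient 1 or -1, the move \<open>b\<close> is an integer combination of
  \<open>u\<close> and the other moves of \<open>Q\<close>. This combination can be carried out as a
  path after adding enough copies of \<open>u\<close>, which are removed at the end.\<close>

lemma is_markov_basis_exchange:
  assumes M: "is_markov_basis D M" and Q: "Q \<subseteq> M" "b \<in> Q"
    and u: "u \<in> nonneg_vecs (dim_col D)" "u \<in> int_span (dim_col D) Q"
    and supp: "\<forall>c\<in>Q. supp_le (dim_col D) c u"
    and pivot: "u - b \<in> int_span (dim_col D) (Q - {b}) \<or> u + b \<in> int_span (dim_col D) (Q - {b})"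
  shows "is_markov_basis D (insert u (M - {b}))"
proof -
  define N where "N = dim_col D"
  define M' where "M' = insert u (M - {b})"
  note [folded N_def] = u pivot supp
  note u = this(1,2) and pivot = this(3) and supp = this(4)
  have MK: "M \<subseteq> mat_kernel D" and fin: "finite M" using M by (auto simp: is_markov_basis_def)
  have "u \<in> mat_kernel D" using int_span_kernel[of u D Q] u(2) Q(1) MK by (auto simp: N_def)
  then have M'K: "M' \<subseteq> mat_kernel D" using MK by (auto simp: M'_def)
  then have M'c: "M' \<subseteq> carrier_vec N" using mat_kernel_carrier[of D] by (auto simp: N_def)
  have Qc: "Q \<subseteq> carrier_vec N" using Q(1) MK mat_kernel_carrier[of D] by (auto simp: N_def)
  have c: "u \<in> carrier_vec N" "b \<in> carrier_vec N" using u Q Qc by (auto simp: nonneg_vecs_def)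
  have uM': "u \<in> M'" by (simp add: M'_def)
  have sub: "Q - {b} \<subseteq> M'" "Q - {b} \<subseteq> carrier_vec N" "\<forall>c\<in>Q - {b}. supp_le N c u"
    using Q Qc supp by (auto simp: M'_def)
  \<comment> \<open>The path climbs from \<open>w\<close> by \<open>k\<close> copies of
    \<open>u\<close>, is translated by \<open>x\<close> to \<open>z\<close> plus
    \<open>k + 1\<close> copies of \<open>u\<close>, and descends to \<open>z\<close>.\<close>
  have shift: "(w, z) \<in> (markov_step N M')\<^sup>*"
    if wz: "w \<in> nonneg_vecs N" "z \<in> nonneg_vecs N"
      and x: "x \<in> int_span N (Q - {b})" "w + x = z + u" for w z x
  proof -
    have zw: "z \<in> carrier_vec N" "w \<in> carrier_vec N" using wz by (auto simp: nonneg_vecs_def)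
    obtain k where k: "(w + int k \<cdot>\<^sub>v u, w + x + int k \<cdot>\<^sub>v u) \<in> (markov_step N M')\<^sup>*"
      using markov_steps_translate[OF x(1) sub u(1) wz(1)] by blast
    have "w + x + int k \<cdot>\<^sub>v u = z + int (Suc k) \<cdot>\<^sub>v u"
      unfolding x(2) using zw c by (intro eq_vecI) (auto simp: algebra_simps)
    then have "(w + int k \<cdot>\<^sub>v u, z) \<in> (markov_step N M')\<^sup>*"
      using k markov_steps_sym[OF M'c markov_steps_multiple[OF uM' u(1) wz(2), of "Suc k"]]
      by (metis rtrancl_trans)
    then show ?thesis
      using markov_steps_multiple[OF uM' u(1) wz(1), of k] by (rule rtrancl_trans[rotated])
  qed
  have move: "(w, w + b) \<in> (markov_step N M')\<^sup>*"
    if w: "w \<in> nonneg_vecs N" "w + b \<in> nonneg_vecs N" for w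
  proof -
    have wc: "w \<in> carrier_vec N" using w by (auto simp: nonneg_vecs_def)
    \<comment> \<open>If \<open>u - b\<close> is a combination without \<open>b\<close>, it leads
      from \<open>w + b\<close> to \<open>w\<close>, and the path is reversed; if
      \<open>u + b\<close> is one, it leads directly from \<open>w\<close> to
      \<open>w + b\<close>.\<close>
    have "(w + b) + (u - b) = w + u" "w + (u + b) = (w + b) + u"
      using wc c by (auto intro!: eq_vecI)
    then show ?thesis
      using pivot shift[OF w(2,1)] shift[OF w] markov_steps_sym[OF M'c] by blast
  qed
  have "(w, z) \<in> (markov_step N M')\<^sup>*" if wz: "(w, z) \<in> markov_step N M" for w z
  proof -
    obtain d where d: "d \<in> M" "z = w + d \<or> z = w - d"
      and nn: "w \<in> nonneg_vecs N" "z \<in> nonneg_vecs N"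
      using wz by (auto simp: markov_step_def)
    show ?thesis
    proof (cases "d = b")
      case True
      have "z = w + b \<or> w = z + b"
        using d(2) True c nn by (auto simp: nonneg_vecs_def intro!: eq_vecI)
      then show ?thesis
        using move nn markov_steps_sym[OF M'c] by metis
    next
      case False
      then have "(w, z) \<in> markov_step N M'"
        using d nn by (auto simp: markov_step_def M'_def)
      then show ?thesis by blast
    qed
  qed
  then have "(markov_step N M)\<^sup>* \<subseteq> (markov_step N M')\<^sup>*"
    by (intro rtrancl_subset_rtrancl) auto
  then show ?thesis
    using M fin M'K unfolding is_markov_basis_def M'_def[symmetric] N_def
    by (auto simp: M'_def)
qed

text \<open>The basis \<open>M\<close> has least cardinality among all Markov bases, minimal or not.
  The exchange does not increase the cardinality, so the new basis is also of least cardinality, and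
  this forces it to be minimal.\<close>

lemma exists_minimal_markov_basis_supp:
  assumes "x \<in> mat_kernel D" "x \<in> nonneg_vecs (dim_col D)" "x \<noteq> 0\<^sub>v (dim_col D)"
  obtains M u where "is_minimal_markov_basis D M" "has_minimal_cardinality D M" "u \<in> M"
    "supp_le (dim_col D) x u"
proof -
  define N where "N = dim_col D"
  obtain M where "is_markov_basis D M \<and> (\<forall>M'. is_markov_basis D M' \<longrightarrow> card M \<le> card M')"
    using ex_has_least_nat[of "is_markov_basis D" _ card, OF is_markov_basis_graver] by blast
  then have M: "is_markov_basis D M"
    and least: "\<And>M'. is_markov_basis D M' \<Longrightarrow> card M \<le> card M'" by blast+
  have Mc: "M \<subseteq> carrier_vec N" and fin: "finite M"
    using M mat_kernel_carrier[of D] unfolding is_markov_basis_def N_def by blast+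
  have "D *\<^sub>v 0\<^sub>v N = D *\<^sub>v x" using assms(1) by (auto simp: N_def mat_kernel_def)
  moreover have "0\<^sub>v N \<in> nonneg_vecs N" by (simp add: nonneg_vecs_def)
  ultimately have "(0\<^sub>v N, x) \<in> (markov_step N M)\<^sup>*"
    using M assms(2) unfolding is_markov_basis_def N_def by blast
  from markov_path_pivot[OF Mc this] obtain Q u where Q: "Q \<subseteq> M" "u \<in> nonneg_vecs N"
    "u \<in> int_span N Q" "\<forall>c\<in>Q. supp_le N c u" and xu: "supp_le N x u"
    and pivot: "u = 0\<^sub>v N \<or>
      (\<exists>b\<in>Q. u - b \<in> int_span N (Q - {b}) \<or> u + b \<in> int_span N (Q - {b}))" by blast
  have "u \<noteq> 0\<^sub>v N"
  proof
    assume "u = 0\<^sub>v N"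
    then have "\<forall>i<N. x $ i = 0" using xu by (simp add: supp_le_def)
    then show False using assms by (auto simp: nonneg_vecs_def N_def)
  qed
  then obtain b where b: "b \<in> Q"
    "u - b \<in> int_span N (Q - {b}) \<or> u + b \<in> int_span N (Q - {b})" using pivot by blast
  define M' where "M' = insert u (M - {b})"
  have M': "is_markov_basis D M'"
    unfolding M'_def using is_markov_basis_exchange[OF M Q(1) b(1)] Q b(2) by (simp add: N_def)
  \<comment> \<open>Counting gives only an inequality, since \<open>u\<close> might already lie in
    \<open>M - {b}\<close>.\<close>
  have "card M' \<le> Suc (card (M - {b}))" unfolding M'_def by (rule card_insert_le_m1) auto
  also have "\<dots> = card M" using b(1) Q(1) fin by (auto intro: card_Suc_Diff1)
  finally have card: "card M' \<le> card M" .
  have least': "card M' \<le> card M''" if "is_markov_basis D M''" for M''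
    using card least[OF that] by (rule order_trans)
  have "finite M'" using fin by (simp add: M'_def)
  then have "\<not> is_markov_basis D M''" if "M'' \<subset> M'" for M''
    using psubset_card_mono[OF _ that] least'[of M''] by linarith
  then have "is_minimal_markov_basis D M'"
    using M' by (simp add: is_minimal_markov_basis_def)
  moreover have "has_minimal_cardinality D M'"
    using least' by (auto simp: has_minimal_cardinality_def is_minimal_markov_basis_def)
  ultimately show thesis using that[of M' u] xu by (simp add: M'_def N_def)
qed

section \<open>The kernel of the generalized Lawrence lifting\<close>

lemma sum_lessThan_mult:
  fixes f :: "nat \<Rightarrow> 'a :: comm_monoid_add"
  shows "(\<Sum>l<r * n. f l) = (\<Sum>k<r. \<Sum>j<n. f (k * n + j))"
proof -
  have "sum f {k * n..<k * n + n} = (\<Sum>j<n. f (k * n + j))" for k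
    using sum.shift_bounds_nat_ivl[of f 0 "k * n" n]
    by (simp add: add.commute atLeast0LessThan)
  moreover have "(\<Sum>l<r * n. f l) = (\<Sum>k<r. sum f {k * n..<k * n + n})"
    by (simp add: sum.nat_group)
  ultimately show ?thesis by simp
qed

lemma block_index_less:
  fixes k j r n :: nat
  assumes "k < r" "j < n"
  shows "k * n + j < r * n"
proof -
  have "k * n + j < Suc k * n" using assms(2) by simp
  also have "\<dots> \<le> r * n" using assms(1) by (intro mult_le_mono1) simp
  finally show ?thesis .
qed

text \<open>Row \<open>k * m + i\<close> of the lifting meets only column block \<open>k\<close>,
  and row \<open>r * m + i\<close> repeats a row of \<open>B\<close> over all blocks. So each row of
  the matrix form of \<open>v\<close> is in the kernel of \<open>A\<close>, and their sum is in the
  kernel of \<open>B\<close>.\<close>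

lemma mem_kernel_lawrence_lifting:
  assumes A: "A \<in> carrier_mat m n" and B: "B \<in> carrier_mat p n"
  shows "v \<in> mat_kernel (lawrence_lifting A B r) \<longleftrightarrow> v \<in> carrier_vec (r * n)
    \<and> (\<forall>k<r. \<forall>i<m. (\<Sum>j<n. A $$ (i, j) * v $ (k * n + j)) = 0)
    \<and> (\<forall>i<p. (\<Sum>k<r. \<Sum>j<n. B $$ (i, j) * v $ (k * n + j)) = 0)"
proof (cases "v \<in> carrier_vec (r * n)")
  case False
  then show ?thesis using A by (auto simp: mat_kernel_def lawrence_lifting_def Let_def)
next
  case v: True
  let ?D = "lawrence_lifting A B r"
  have dim: "dim_row ?D = r * m + p" "dim_col ?D = r * n"
    using A B by (auto simp: lawrence_lifting_def Let_def)
  have entry: "(?D *\<^sub>v v) $ l = (\<Sum>k<r. \<Sum>j<n. ?D $$ (l, k * n + j) * v $ (k * n + j))"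
    if "l < r * m + p" for l
  proof -
    have "(?D *\<^sub>v v) $ l = (\<Sum>c<r * n. ?D $$ (l, c) * v $ c)"
      using that v dim by (simp add: scalar_prod_def atLeast0LessThan)
    then show ?thesis by (simp add: sum_lessThan_mult)
  qed
  have top: "(?D *\<^sub>v v) $ (k * m + i) = (\<Sum>j<n. A $$ (i, j) * v $ (k * n + j))"
    if k: "k < r" and i: "i < m" for k i
  proof -
    have l: "k * m + i < r * m" by (rule block_index_less[OF k i])
    have "?D $$ (k * m + i, k' * n + j) = (if k' = k then A $$ (i, j) else 0)"
      if "k' < r" "j < n" for k' j
      using that A B l i block_index_less[OF that]
      by (auto simp: lawrence_lifting_def Let_def)
    then have "(?D *\<^sub>v v) $ (k * m + i) =
        (\<Sum>k'<r. \<Sum>j<n. (if k' = k then A $$ (i, j) else 0) * v $ (k' * n + j))"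
      using l by (simp add: entry)
    also have "\<dots> = (\<Sum>k'<r. if k' = k then (\<Sum>j<n. A $$ (i, j) * v $ (k * n + j)) else 0)"
      by (intro sum.cong) auto
    finally show ?thesis using k by simp
  qed
  have bottom: "(?D *\<^sub>v v) $ (r * m + i) = (\<Sum>k<r. \<Sum>j<n. B $$ (i, j) * v $ (k * n + j))"
    if i: "i < p" for i
  proof -
    have "?D $$ (r * m + i, k * n + j) = B $$ (i, j)" if "k < r" "j < n" for k j
      using that A B i block_index_less[OF that]
      by (auto simp: lawrence_lifting_def Let_def)
    then show ?thesis using i by (simp add: entry)
  qed
  have "v \<in> mat_kernel ?D \<longleftrightarrow> (\<forall>l<r * m + p. (?D *\<^sub>v v) $ l = 0)"
    using v dim by (simp add: mat_kernel_def vec_eq_iff[of "?D *\<^sub>v v"] del: index_mult_mat_vec)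
  also have "\<dots> \<longleftrightarrow> (\<forall>k<r. \<forall>i<m. (?D *\<^sub>v v) $ (k * m + i) = 0) \<and>
      (\<forall>i<p. (?D *\<^sub>v v) $ (r * m + i) = 0)" (is "?L \<longleftrightarrow> ?R")
  proof
    assume ?L
    then show ?R using block_index_less[of _ r _ m] by (auto simp: trans_less_add1)
  next
    assume R: ?R
    have "(?D *\<^sub>v v) $ l = 0" if l: "l < r * m + p" for l
    proof (cases "l < r * m")
      case True
      \<comment> \<open>Positivity of \<open>m\<close> comes from \<open>r * m\<close> exceeding
        \<open>l\<close>; it allows \<open>l\<close> to be split into block number and
        offset.\<close>
      then have "0 < m" by (cases m) auto
      then have "l div m < r" "l mod m < m"
        using True by (auto simp: less_mult_imp_div_less)
      then have "(?D *\<^sub>v v) $ (l div m * m + l mod m) = 0" using R by blast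
      then show ?thesis by simp
    next
      case False
      then have "l = r * m + (l - r * m)" "l - r * m < p" using l by auto
      then show ?thesis using R by metis
    qed
    then show ?L by blast
  qed
  finally show ?thesis using v top bottom by auto
qed

section \<open>Vectors with equal rows and the element of full type\<close>

definition equal_rows_vec :: "nat \<Rightarrow> nat \<Rightarrow> int vec \<Rightarrow> int vec" where
  "equal_rows_vec r n v = vec (r * n) (\<lambda>l. \<Sum>k<r. v $ (k * n + l mod n))"

lemma equal_rows_vec_carrier: "equal_rows_vec r n v \<in> carrier_vec (r * n)"
  by (simp add: equal_rows_vec_def)

lemma equal_rows_vec_index:
  "k < r \<Longrightarrow> j < n \<Longrightarrow> equal_rows_vec r n v $ (k * n + j) = (\<Sum>k'<r. v $ (k' * n + j))"
  by (simp add: equal_rows_vec_def block_index_less)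

text \<open>The sum of the rows of \<open>v\<close> lies in the kernels of both \<open>A\<close> and
  \<open>B\<close>, so copies of it in all rows satisfy every equation of the lifting.\<close>

lemma equal_rows_vec_kernel:
  assumes A: "A \<in> carrier_mat m n" and B: "B \<in> carrier_mat p n"
    and v: "v \<in> mat_kernel (lawrence_lifting A B r)"
  shows "equal_rows_vec r n v \<in> mat_kernel (lawrence_lifting A B r)"
proof -
  have swap: "(\<Sum>j<n. f j * equal_rows_vec r n v $ (k * n + j)) =
      (\<Sum>k'<r. \<Sum>j<n. f j * v $ (k' * n + j))" if "k < r" for f k
  proof -
    have "(\<Sum>j<n. f j * equal_rows_vec r n v $ (k * n + j)) =
        (\<Sum>j<n. \<Sum>k'<r. f j * v $ (k' * n + j))"
      using that by (simp add: equal_rows_vec_index sum_distrib_left)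
    then show ?thesis by (subst sum.swap)
  qed
  show ?thesis
    using v unfolding mem_kernel_lawrence_lifting[OF A B]
    by (auto simp: swap equal_rows_vec_carrier)
qed

theorem theorem3p5:
  fixes m n p r :: nat and A B :: "int mat"
  assumes "m \<ge> 1" and "n \<ge> 1" and "p \<ge> 1" and "r \<ge> 2"
    and "A \<in> carrier_mat m n" and "B \<in> carrier_mat p n"
    and "non_positive_lattice (r * n) (mat_kernel (lawrence_lifting A B r))"
  shows "\<exists>M. is_minimal_markov_basis (lawrence_lifting A B r) M
           \<and> has_minimal_cardinality (lawrence_lifting A B r) M
           \<and> (\<exists>C \<in> M. vec_type r n C = r)"
proof -
  let ?D = "lawrence_lifting A B r"
  have dim: "dim_col ?D = r * n" using assms(5) by (auto simp: lawrence_lifting_def Let_def)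
  \<comment> \<open>Zero lies in the intersection, so an intersection other than the zero singleton
    has a nonzero element.\<close>
  have "0\<^sub>v (r * n) \<in> mat_kernel ?D \<inter> nonneg_vecs (r * n)"
    by (auto simp: mem_kernel_lawrence_lifting[OF assms(5,6)] nonneg_vecs_def block_index_less)
  then obtain v where v: "v \<in> mat_kernel ?D" "v \<in> nonneg_vecs (r * n)" "v \<noteq> 0\<^sub>v (r * n)"
    using assms(7) unfolding non_positive_lattice_def by auto
  have v0: "0 \<le> v $ (k * n + j)" if "k < r" "j < n" for k j
    using v(2) block_index_less[OF that] by (simp add: nonneg_vecs_def)
  obtain l where l: "l < r * n" "v $ l \<noteq> 0"
    using v by (metis (no_types, lifting) carrier_vecD eq_vecI index_zero_vec mem_Collect_eq
        nonneg_vecs_def)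
  \<comment> \<open>In column \<open>j\<close> the nonnegative \<open>v\<close> has a positive
    entry, so the column sum, which is the entry of \<open>x\<close> there in every row, is
    positive.\<close>
  define j where "j = l mod n"
  have j: "j < n" using assms(2) by (simp add: j_def)
  have ldiv: "l div n < r" using l(1) by (simp add: less_mult_imp_div_less)
  have "l div n * n + j = l" by (simp add: j_def)
  define x where "x = equal_rows_vec r n v"
  have "x $ l' \<ge> 0" if "l' < r * n" for l'
  proof -
    have "0 \<le> v $ (k * n + l' mod n)" if "k < r" for k
      using v0[OF that] assms(2) by simp
    then show ?thesis using that by (auto simp: x_def equal_rows_vec_def intro!: sum_nonneg)
  qed
  then have x_nonneg: "x \<in> nonneg_vecs (r * n)"
    by (auto simp: nonneg_vecs_def x_def equal_rows_vec_def)
  have "0 < (\<Sum>k<r. v $ (k * n + j))"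
    using v0[OF _ j] v0[OF ldiv j] ldiv l(2) \<open>l div n * n + j = l\<close>
    by (intro sum_pos2[of _ "l div n"]) auto
  then have x_pos: "0 < x $ (k * n + j)" if "k < r" for k
    using that j by (simp add: x_def equal_rows_vec_index)
  have "x \<noteq> 0\<^sub>v (r * n)"
    using x_pos[of 0] block_index_less[of 0 r j n] assms(4) j by auto
  then obtain M u where M: "is_minimal_markov_basis ?D M" "has_minimal_cardinality ?D M" "u \<in> M"
    and xu: "supp_le (r * n) x u"
    using exists_minimal_markov_basis_supp[of x ?D] equal_rows_vec_kernel[OF assms(5,6) v(1)]
      x_nonneg unfolding dim x_def by blast
  \<comment> \<open>The support of \<open>u\<close> contains that of \<open>x\<close>, hence column
    \<open>j\<close> of every row.\<close>
  have "row (vec_to_rows r n u) k \<noteq> 0\<^sub>v n" if k: "k < r" for k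
  proof
    assume z: "row (vec_to_rows r n u) k = 0\<^sub>v n"
    have "u $ (k * n + j) = 0"
      using arg_cong[OF z, of "\<lambda>w. w $ j"] k j by (simp add: vec_to_rows_def)
    then show False
      using xu x_pos[OF k] block_index_less[OF k j] by (auto simp: supp_le_def)
  qed
  then have "{i. i < r \<and> row (vec_to_rows r n u) i \<noteq> 0\<^sub>v n} = {..<r}" by auto
  then have "vec_type r n u = r" by (simp add: vec_type_def)
  then show ?thesis using M by blast
qed

end
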